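(* Let $N, T, k, d_1,\dots,d_N$ be positive integers and fix $\mathbf{x}\in\mathbb{R}^{\prod_{n=1}^N d_n}$. For each $t\in\{1,\dots,T\}$ and $n\in\{1,\dots,N\}$ let $\mathbf{A}_n^{(t)}\in\mathbb{R}^{d_n\times k}$ be a random matrix whose columns are independent random vectors in $\mathbb{R}^{d_n}$ with mean zero and identity covariance matrix (the entries are not required to be i.i.d.), and suppose that the $NT$ matrices $\mathbf{A}_n^{(t)}$ are mutually independent. Let $f_{\mathrm{TRP}(T)}$ be the TRP$(T)$ map of order $N$ formed from these matrices. Then $$\mathbb{E}\,\|f_{\mathrm{TRP}(T)}(\mathbf{x})\|_2^2=\|\mathbf{x}\|_2^2 .$$
   Context: For $\mathbf{A}\in\mathbb{R}^{I\times K}$ and $\mathbf{B}\in\mathbb{R}^{J\times K}$, the Khatri-Rao product $\mathbf{A}\odot\mathbf{B}\in\mathbb{R}^{IJ\times K}$ is the column-wise Kronecker product: its $j$-th column is $\mathbf{A}(\cdot,j)\otimes\mathbf{B}(\cdot,j)$. Tensor random projection (TRP) of order $N$ with range $k$: given random matrices $\mathbf{A}_n\in\mathbb{R}^{d_n\times k}$, $n=1,\dots,N$, it is the random linear map $f_{\mathrm{TRP}}:\mathbb{R}^{\prod_n d_n}\to\mathbb{R}^k$, $$f_{\mathrm{TRP}}(\mathbf{x})=\frac{1}{\sqrt{k}}(\mathbf{A}_1\odot\cdots\odot\mathbf{A}_N)^\top\mathbf{x}.$$ TRP$(T)$: given $T$ independent TRPs $f^{(1)}_{\mathrm{TRP}},\dots,f^{(T)}_{\mathrm{TRP}}$,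 where $f^{(t)}_{\mathrm{TRP}}$ is formed from $\mathbf{A}_1^{(t)},\dots,\mathbf{A}_N^{(t)}$, $$f_{\mathrm{TRP}(T)}(\mathbf{x})=\frac{1}{\sqrt{T}}\sum_{t=1}^T f^{(t)}_{\mathrm{TRP}}(\mathbf{x}).$$ The case $T=1$ is the TRP itself. *)

theory Defs
  imports "HOL-Probability.Probability" "Jordan_Normal_Form.Matrix"
begin

unbundle no vec_syntax
hide_const (open) Finite_Cartesian_Product.vec Finite_Cartesian_Product.mat
hide_type (open) Finite_Cartesian_Product.vec

section \<open>Khatri-Rao products\<close>

definition kron_vec :: "real vec \<Rightarrow> real vec \<Rightarrow> real vec" where
  "kron_vec u v = vec (dim_vec u * dim_vec v) (\<lambda>i. u $ (i div dim_vec v) * v $ (i mod dim_vec v))"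

definition khatri_rao :: "real mat \<Rightarrow> real mat \<Rightarrow> real mat" (infixl \<open>\<odot>\<close> 70) where
  "A \<odot> B = mat_of_cols (dim_row A * dim_row B)
     (map (\<lambda>j. kron_vec (col A j) (col B j)) [0..<dim_col A])"

text \<open>The product of the matrices with indices $1, \dots, N$, for $N \ge 1$. The operation is
  associative, so bracketing to the left is immaterial. For $N = 0$ the value is junk.\<close>

definition khatri_rao_upto :: "nat \<Rightarrow> (nat \<Rightarrow> real mat) \<Rightarrow> real mat" where
  "khatri_rao_upto N A = foldl (\<odot>) (A 1) (map A [2..<Suc N])"

section \<open>Tensor random projections\<close>

definition trp :: "nat \<Rightarrow> nat \<Rightarrow> (nat \<Rightarrow> real mat) \<Rightarrow> real vec \<Rightarrow> real vec" where
  "trp N k A x = (1 / sqrt (real k)) \<cdot>\<^sub>v (transpose_mat (khatri_rao_upto N A) *\<^sub>v x)"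

definition trp_avg :: "nat \<Rightarrow> nat \<Rightarrow> nat \<Rightarrow> (nat \<Rightarrow> nat \<Rightarrow> real mat) \<Rightarrow> real vec \<Rightarrow> real vec" where
  "trp_avg N k T A x =
     (1 / sqrt (real T)) \<cdot>\<^sub>v finsum_vec TYPE(real) k (\<lambda>t. trp N k (A t) x) {1..T}"

definition norm2_vec :: "real vec \<Rightarrow> real" where
  "norm2_vec v = L2_set (\<lambda>i. v $ i) {..<dim_vec v}"

section \<open>Random vectors and matrices\<close>

text \<open>The Borel sigma-algebras on $\mathbb{R}^n$ and $\mathbb{R}^{m \times n}$, transported from
  the finite product of copies of the Borel algebra of the reals along the coordinate map.\<close>

definition vec_borel :: "nat \<Rightarrow> real vec measure" where
  "vec_borel n = vimage_algebra (carrier_vec n)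
     (\<lambda>v. \<lambda>i\<in>{..<n}. v $ i) (\<Pi>\<^sub>M i\<in>{..<n}. borel)"

definition mat_borel :: "nat \<Rightarrow> nat \<Rightarrow> real mat measure" where
  "mat_borel m n = vimage_algebra (carrier_mat m n)
     (\<lambda>A. \<lambda>ij\<in>{..<m} \<times> {..<n}. A $$ ij) (\<Pi>\<^sub>M ij\<in>{..<m} \<times> {..<n}. borel)"

definition mean_vec :: "'w measure \<Rightarrow> nat \<Rightarrow> ('w \<Rightarrow> real vec) \<Rightarrow> real vec" where
  "mean_vec M n X = vec n (\<lambda>i. \<integral>w. X w $ i \<partial>M)"

definition cov_mat :: "'w measure \<Rightarrow> nat \<Rightarrow> ('w \<Rightarrow> real vec) \<Rightarrow> real mat" where
  "cov_mat M n X = mat n n (\<lambda>(i, j).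
     \<integral>w. (X w $ i - mean_vec M n X $ i) * (X w $ j - mean_vec M n X $ j) \<partial>M)"

text \<open>Square integrability is stated explicitly because the integral of a non-integrable function
  is 0 by convention; on a probability space it makes the mean and the covariance meaningful.\<close>

definition standardized :: "'w measure \<Rightarrow> nat \<Rightarrow> ('w \<Rightarrow> real vec) \<Rightarrow> bool" where
  "standardized M n X \<longleftrightarrow>
     (\<forall>i<n. integrable M (\<lambda>w. (X w $ i)\<^sup>2)) \<and>
     mean_vec M n X = 0\<^sub>v n \<and> cov_mat M n X = 1\<^sub>m n"

end

theory Submission
  imports Defs
begin

text \<open>Every entry of the Khatri-Rao product is a product of one entry from each factor, whose row
  indices are the mixed-radix digits of the row index. Expanding the squared norm therefore reduces
  the claim to the orthonormality, in $L^2$, of these products over all pairs of a replica $t$ and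
  a row $i$, for a fixed column. By independence the expectation of a product of two of them
  factorizes; for equal replicas each factor is a Kronecker delta of digits, and for different
  replicas some factor is a mean.\<close>

section \<open>Mixed-radix digits and entries of Khatri-Rao products\<close>

text \<open>In a Kronecker product the index of the right factor varies fastest. Hence position
  \<open>N\<close> is the least significant one, and the place value of position \<open>n\<close> is
  the product of the later bases.\<close>

definition radix_digit :: "(nat \<Rightarrow> nat) \<Rightarrow> nat \<Rightarrow> nat \<Rightarrow> nat \<Rightarrow> nat" where
  "radix_digit d N i n = i div (\<Prod>m=Suc n..N. d m) mod d n"

text \<open>Appending a base multiplies the place value of every earlier position by
  \<open>d (Suc N)\<close>, and division by a product is iterated division. This drives the
  inductions on \<open>N\<close> below.\<close>

lemma radix_digit_Suc:
  assumes "n \<le> N"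
  shows "radix_digit d (Suc N) i n = radix_digit d N (i div d (Suc N)) n"
proof -
  have "(\<Prod>m=Suc n..Suc N. d m) = d (Suc N) * (\<Prod>m=Suc n..N. d m)"
    using assms by (simp add: mult.commute)
  then show ?thesis
    by (simp add: radix_digit_def div_mult2_eq)
qed

lemma radix_digit_last: "radix_digit d N i N = i mod d N"
  by (simp add: radix_digit_def)

lemma radix_digit_less: "d n > 0 \<Longrightarrow> radix_digit d N i n < d n"
  by (simp add: radix_digit_def)

text \<open>Induction strips the last digit: quotient and remainder by the last base determine the
  number. The upper bounds matter because the leading digit is also reduced modulo its base.\<close>

lemma radix_digit_inject:
  assumes "i < (\<Prod>n=1..N. d n)" and "i' < (\<Prod>n=1..N. d n)"
    and "\<And>n. n \<in> {1..N} \<Longrightarrow> radix_digit d N i n = radix_digit d N i' n"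
  shows "i = i'"
  using assms
proof (induction N arbitrary: i i')
  case 0
  then show ?case by simp
next
  case (Suc N)
  let ?b = "d (Suc N)"
  have "i div ?b = i' div ?b"
  proof (rule Suc.IH)
    show "i div ?b < (\<Prod>n=1..N. d n)" "i' div ?b < (\<Prod>n=1..N. d n)"
      using Suc.prems(1,2) by (simp_all add: less_mult_imp_div_less)
    show "radix_digit d N (i div ?b) n = radix_digit d N (i' div ?b) n" if "n \<in> {1..N}" for n
      using Suc.prems(3)[of n] that by (simp add: radix_digit_Suc)
  qed
  moreover have "i mod ?b = i' mod ?b"
    using Suc.prems(3)[of "Suc N"] by (simp add: radix_digit_last)
  ultimately show ?case by (metis div_mult_mod_eq)
qed

section \<open>Dimensions and entries of iterated Khatri-Rao products\<close>

lemma khatri_rao_carrier: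
  assumes "A \<in> carrier_mat m k" and "B \<in> carrier_mat n k"
  shows "A \<odot> B \<in> carrier_mat (m * n) k"
  using assms by (auto simp: khatri_rao_def)

lemma khatri_rao_index:
  assumes "A \<in> carrier_mat m k" and "B \<in> carrier_mat n k" and "i < m * n" and "j < k"
  shows "(A \<odot> B) $$ (i, j) = A $$ (i div n, j) * B $$ (i mod n, j)"
proof -
  have "n > 0" using assms(3) by (cases n) auto
  then have "i div n < m" "i mod n < n"
    using assms(3) by (simp_all add: less_mult_imp_div_less)
  then show ?thesis
    using assms by (auto simp: khatri_rao_def kron_vec_def mat_of_cols_def)
qed

lemma khatri_rao_upto_1: "khatri_rao_upto (Suc 0) A = A 1"
  by (simp add: khatri_rao_upto_def)

text \<open>Folding from the left exposes the last factor. At \<open>N = 0\<close> the equation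
  would read \<open>A 1\<close> on the left and \<open>A 1\<close> times itself on the right,
  because the seed \<open>A 1\<close> is present even for an empty list.\<close>

lemma khatri_rao_upto_Suc:
  "N \<ge> 1 \<Longrightarrow> khatri_rao_upto (Suc N) A = khatri_rao_upto N A \<odot> A (Suc N)"
  by (simp add: khatri_rao_upto_def)

lemma khatri_rao_upto_carrier:
  assumes "N \<ge> 1" and "\<And>n. n \<in> {1..N} \<Longrightarrow> A n \<in> carrier_mat (d n) k"
  shows "khatri_rao_upto N A \<in> carrier_mat (\<Prod>n=1..N. d n) k"
  using assms
proof (induction N rule: dec_induct)
  case base
  then show ?case by (simp add: khatri_rao_upto_1)
next
  case (step N)
  then show ?case
    using khatri_rao_carrier[of "khatri_rao_upto N A" "\<Prod>n=1..N. d n" k "A (Suc N)" "d (Suc N)"]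
    by (simp add: khatri_rao_upto_Suc)
qed

lemma khatri_rao_upto_index:
  assumes "N \<ge> 1" and "\<And>n. n \<in> {1..N} \<Longrightarrow> A n \<in> carrier_mat (d n) k"
    and "i < (\<Prod>n=1..N. d n)" and "j < k"
  shows "khatri_rao_upto N A $$ (i, j) = (\<Prod>n=1..N. A n $$ (radix_digit d N i n, j))"
  using assms
proof (induction N arbitrary: i rule: dec_induct)
  case base
  then show ?case
    \<comment> \<open>With a single base the digit is \<open>i mod d 1\<close>, which is
      \<open>i\<close> by the bound on \<open>i\<close>.\<close>
    by (simp add: khatri_rao_upto_1 radix_digit_last[of d "Suc 0", simplified])
next
  case (step N)
  let ?b = "d (Suc N)"
  have less: "i < (\<Prod>n=1..N. d n) * ?b"
    using step.prems(2) by simp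
  have "khatri_rao_upto (Suc N) A $$ (i, j) =
      khatri_rao_upto N A $$ (i div ?b, j) * A (Suc N) $$ (i mod ?b, j)"
    unfolding khatri_rao_upto_Suc[OF step.hyps(1)]
  proof (rule khatri_rao_index[OF _ _ less step.prems(3)])
    show "khatri_rao_upto N A \<in> carrier_mat (\<Prod>n=1..N. d n) k"
      using step.hyps(1) step.prems(1) by (intro khatri_rao_upto_carrier) auto
    show "A (Suc N) \<in> carrier_mat ?b k"
      using step.prems(1) by simp
  qed
  also have "khatri_rao_upto N A $$ (i div ?b, j) =
      (\<Prod>n=1..N. A n $$ (radix_digit d N (i div ?b) n, j))"
    using step.prems less by (intro step.IH) (auto simp: less_mult_imp_div_less)
  also have "\<dots> = (\<Prod>n=1..N. A n $$ (radix_digit d (Suc N) i n, j))"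
    by (intro prod.cong) (auto simp: radix_digit_Suc)
  finally show ?case
    by (simp add: radix_digit_last)
qed

section \<open>Coordinates and squared norm of the projections\<close>

lemma norm2_vec_sq: "(norm2_vec v)\<^sup>2 = (\<Sum>i<dim_vec v. (v $ i)\<^sup>2)"
  by (simp add: norm2_vec_def L2_set_def sum_nonneg)

lemma trp_carrier:
  assumes "N \<ge> 1" and "\<And>n. n \<in> {1..N} \<Longrightarrow> A n \<in> carrier_mat (d n) k"
  shows "trp N k A x \<in> carrier_vec k"
  using khatri_rao_upto_carrier[of N A d k, OF assms] by (auto simp: trp_def intro!: carrier_vecI)

lemma trp_index:
  assumes "N \<ge> 1" and "\<And>n. n \<in> {1..N} \<Longrightarrow> A n \<in> carrier_mat (d n) k"
    and "x \<in> carrier_vec (\<Prod>n=1..N. d n)" and "j < k"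
  shows "trp N k A x $ j = 1 / sqrt (real k) *
    (\<Sum>i<(\<Prod>n=1..N. d n). x $ i * (\<Prod>n=1..N. A n $$ (radix_digit d N i n, j)))"
proof -
  let ?K = "khatri_rao_upto N A" and ?D = "\<Prod>n=1..N. d n"
  have K: "?K \<in> carrier_mat ?D k"
    using khatri_rao_upto_carrier assms(1,2) .
  have "trp N k A x $ j = 1 / sqrt (real k) * (\<Sum>i<?D. ?K $$ (i, j) * x $ i)"
    using K assms(3,4) by (simp add: trp_def scalar_prod_def lessThan_atLeast0)
  also have "(\<Sum>i<?D. ?K $$ (i, j) * x $ i) =
      (\<Sum>i<?D. x $ i * (\<Prod>n=1..N. A n $$ (radix_digit d N i n, j)))"
    using khatri_rao_upto_index[of N A d k, OF assms(1,2) _ assms(4)] by (intro sum.cong) auto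
  finally show ?thesis .
qed

text \<open>Replicas and rows are merged into one index set, so that each column contributes the
  square of a single linear combination of random products. The two square-root scalings combine to
  the outer factor.\<close>

lemma trp_avg_norm2_sq:
  assumes "N \<ge> 1" and "\<And>t n. t \<in> {1..T} \<Longrightarrow> n \<in> {1..N} \<Longrightarrow> A t n \<in> carrier_mat (d n) k"
    and "x \<in> carrier_vec (\<Prod>n=1..N. d n)"
  shows "(norm2_vec (trp_avg N k T A x))\<^sup>2 = 1 / (real T * real k) *
    (\<Sum>j<k. (\<Sum>(t, i)\<in>{1..T} \<times> {..<\<Prod>n=1..N. d n}.
       x $ i * (\<Prod>n=1..N. A t n $$ (radix_digit d N i n, j)))\<^sup>2)"
proof -
  let ?D = "\<Prod>n=1..N. d n"
  let ?S = "\<lambda>j. \<Sum>(t, i)\<in>{1..T} \<times> {..<?D}. x $ i * (\<Prod>n=1..N. A t n $$ (radix_digit d N i n, j))"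
  \<comment> \<open>The closure and index rules for \<open>finsum_vec\<close> require all summands
    to lie in a common carrier.\<close>
  have car: "(\<lambda>t. trp N k (A t) x) \<in> {1..T} \<rightarrow> carrier_vec k"
    using assms(1,2) by (intro Pi_I trp_carrier[where d = d])
  have dim: "dim_vec (trp_avg N k T A x) = k"
    using finsum_vec_closed[OF car] by (simp add: trp_avg_def)
  have idx: "trp_avg N k T A x $ j = 1 / sqrt (real T) * (1 / sqrt (real k)) * ?S j" if "j < k" for j
  proof -
    have "trp_avg N k T A x $ j = 1 / sqrt (real T) * (\<Sum>t=1..T. trp N k (A t) x $ j)"
      using finsum_vec_closed[OF car] that
      by (simp add: trp_avg_def index_finsum_vec[OF _ that car] del: One_nat_def)
    also have "(\<Sum>t=1..T. trp N k (A t) x $ j) = (\<Sum>t=1..T. 1 / sqrt (real k) *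
        (\<Sum>i<?D. x $ i * (\<Prod>n=1..N. A t n $$ (radix_digit d N i n, j))))"
      using assms that by (intro sum.cong trp_index refl)
    also have "\<dots> = 1 / sqrt (real k) * ?S j"
      unfolding sum_distrib_left[symmetric] sum.cartesian_product ..
    finally show ?thesis by simp
  qed
  have "(norm2_vec (trp_avg N k T A x))\<^sup>2 =
      (\<Sum>j<k. (1 / sqrt (real T) * (1 / sqrt (real k)) * ?S j)\<^sup>2)"
    unfolding norm2_vec_sq dim by (intro sum.cong) (auto simp: idx)
  also have "\<dots> = 1 / (real T * real k) * (\<Sum>j<k. (?S j)\<^sup>2)"
    by (simp only: power_mult_distrib power_divide real_sqrt_pow2 of_nat_0_le_iff power_one
        sum_distrib_left[symmetric] times_divide_times_eq mult_1_left)
  finally show ?thesis .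
qed

section \<open>Second moments\<close>

lemma measurable_mat_borel_index:
  assumes "i < m" and "j < n"
  shows "(\<lambda>B. B $$ (i, j)) \<in> mat_borel m n \<rightarrow>\<^sub>M borel"
proof -
  let ?f = "\<lambda>A. \<lambda>ij\<in>{..<m} \<times> {..<n}. A $$ ij"
  have "?f \<in> mat_borel m n \<rightarrow>\<^sub>M (\<Pi>\<^sub>M ij\<in>{..<m} \<times> {..<n}. (borel :: real measure))"
    unfolding mat_borel_def by (rule measurable_vimage_algebra1) (auto simp: space_PiM)
  from measurable_compose[OF this measurable_component_singleton[of "(i, j)"]]
  show ?thesis using assms by simp
qed

lemma space_mat_borel: "space (mat_borel m n) = carrier_mat m n"
  by (simp add: mat_borel_def)

lemma square_integrable_product:
  fixes X Y :: "'w \<Rightarrow> real"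
  assumes "X \<in> borel_measurable M" and "Y \<in> borel_measurable M"
    and "integrable M (\<lambda>w. (X w)\<^sup>2)" and "integrable M (\<lambda>w. (Y w)\<^sup>2)"
  shows "integrable M (\<lambda>w. X w * Y w)"
proof (rule Bochner_Integration.integrable_bound)
  show "integrable M (\<lambda>w. (X w)\<^sup>2 + (Y w)\<^sup>2)"
    using assms by simp
  \<comment> \<open>AM-GM is applied to the absolute values; the spare factor 2 is dropped by
    nonnegativity.\<close>
  have "\<bar>x * y\<bar> \<le> x\<^sup>2 + y\<^sup>2" for x y :: real
  proof -
    have "2 * (\<bar>x\<bar> * \<bar>y\<bar>) \<le> x\<^sup>2 + y\<^sup>2"
      using sum_squares_bound[of "\<bar>x\<bar>" "\<bar>y\<bar>"] by (simp add: mult.assoc)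
    moreover have "0 \<le> \<bar>x\<bar> * \<bar>y\<bar>" by simp
    ultimately show ?thesis unfolding abs_mult by linarith
  qed
  then show "AE w in M. norm (X w * Y w) \<le> norm ((X w)\<^sup>2 + (Y w)\<^sup>2)"
    by simp
qed (use assms in measurable)

lemma standardized_mean:
  assumes "standardized M n X" and "i < n"
  shows "(\<integral>w. X w $ i \<partial>M) = 0"
  using assms unfolding standardized_def mean_vec_def by (metis index_vec index_zero_vec(1))

text \<open>Since the mean vanishes, the covariance is the uncentred second moment.\<close>

lemma standardized_second_moment:
  assumes "standardized M n X" and "i < n" and "i' < n"
  shows "(\<integral>w. X w $ i * X w $ i' \<partial>M) = of_bool (i = i')"
proof -
  have "cov_mat M n X $$ (i, i') = 1\<^sub>m n $$ (i, i')"
    using assms(1) by (simp add: standardized_def)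
  moreover have "mean_vec M n X = 0\<^sub>v n"
    using assms(1) by (simp add: standardized_def)
  ultimately show ?thesis
    using assms(2,3) by (simp add: cov_mat_def)
qed

text \<open>Both cases \<open>t = s\<close> and \<open>t \<noteq> s\<close> are treated at once by writing the integrand as one product
  over all of \<open>{1..T} \<times> {1..N}\<close>, padded with factors 1.\<close>

lemma (in prob_space) khatri_rao_entries_orthonormal:
  fixes A :: "nat \<Rightarrow> nat \<Rightarrow> 'a \<Rightarrow> real mat"
  assumes N: "N \<ge> 1" and j: "j < k"
    and meas: "\<And>t n. t \<in> {1..T} \<Longrightarrow> n \<in> {1..N} \<Longrightarrow> A t n \<in> M \<rightarrow>\<^sub>M mat_borel (d n) k"
    and std: "\<And>t n. t \<in> {1..T} \<Longrightarrow> n \<in> {1..N} \<Longrightarrow> standardized M (d n) (\<lambda>w. col (A t n w) j)"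
    and indep: "indep_vars (\<lambda>(t, n). mat_borel (d n) k) (\<lambda>(t, n). A t n) ({1..T} \<times> {1..N})"
    and t: "t \<in> {1..T}" and s: "s \<in> {1..T}"
    and p: "\<And>n. n \<in> {1..N} \<Longrightarrow> p n < d n" and q: "\<And>n. n \<in> {1..N} \<Longrightarrow> q n < d n"
  defines "F \<equiv> \<lambda>w. (\<Prod>n=1..N. A t n w $$ (p n, j)) * (\<Prod>n=1..N. A s n w $$ (q n, j))"
  shows "integrable M F"
    and "expectation F = of_bool (t = s \<and> (\<forall>n\<in>{1..N}. p n = q n))"
proof -
  \<comment> \<open>Each factor is a deterministic function \<open>g\<close> of a single matrix, so
    independence passes from the matrices to the factors by composition.\<close>
  define g where "g = (\<lambda>(r, n) B. (if r = t then B $$ (p n, j) else 1) *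
    (if r = s then B $$ (q n, j) else (1::real)))"
  define X where "X = (\<lambda>rn w. g rn (case rn of (r, n) \<Rightarrow> A r n w))"
  let ?I = "{1..T} \<times> {1..N}"
  have F_eq: "F = (\<lambda>w. \<Prod>rn\<in>?I. X rn w)"
  proof
    fix w
    have pad: "(\<Prod>r=1..T. \<Prod>n=1..N. if r = t' then f r n else 1) = (\<Prod>n=1..N. f t' n)"
      if "t' \<in> {1..T}" for t' and f :: "nat \<Rightarrow> nat \<Rightarrow> real"
    proof -
      have "(\<Prod>r=1..T. \<Prod>n=1..N. if r = t' then f r n else 1) =
          (\<Prod>r=1..T. if r = t' then \<Prod>n=1..N. f r n else 1)"
        by (intro prod.cong) auto
      then show ?thesis using that by (simp add: prod.delta)
    qed
    have "(\<Prod>rn\<in>?I. X rn w) = (\<Prod>r=1..T. \<Prod>n=1..N. X (r, n) w)"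
      by (simp add: prod.cartesian_product)
    also have "\<dots> = (\<Prod>r=1..T. \<Prod>n=1..N. if r = t then A r n w $$ (p n, j) else 1) *
        (\<Prod>r=1..T. \<Prod>n=1..N. if r = s then A r n w $$ (q n, j) else 1)"
      by (simp add: X_def g_def prod.distrib)
    also have "\<dots> = F w"
      unfolding pad[OF t] pad[OF s] F_def ..
    finally show "F w = (\<Prod>rn\<in>?I. X rn w)" ..
  qed
  have g_meas: "g (r, n) \<in> mat_borel (d n) k \<rightarrow>\<^sub>M borel" if "n \<in> {1..N}" for r n
    using measurable_mat_borel_index[OF p[OF that] j] measurable_mat_borel_index[OF q[OF that] j]
    unfolding g_def by (auto intro!: borel_measurable_times)
  have X_indep: "indep_vars (\<lambda>_. borel) X ?I"
    using indep_vars_compose[OF indep, of g "\<lambda>_. borel"] g_meas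
    by (auto simp: comp_def X_def[abs_def] case_prod_unfold)
  \<comment> \<open>According to whether \<open>r\<close> equals both, one or neither of
    \<open>t\<close> and \<open>s\<close>, the factor is a product of two entries of one column, a
    single entry, or the constant 1. Its expectation is then a second moment, a mean, or the total
    mass.\<close>
  have X_int: "integrable M (X (r, n)) \<and> expectation (X (r, n)) =
      (if r = t then if r = s then of_bool (p n = q n) else 0 else if r = s then 0 else 1)"
    if r: "r \<in> {1..T}" and n: "n \<in> {1..N}" for r n
  proof -
    \<comment> \<open>The dimensions of \<open>A r n w\<close> are known only on
      \<open>space M\<close>, so columns are traded for entries through congruence rules for
      integrals.\<close>
    have col: "col (A r n w) j $ i = A r n w $$ (i, j)" if "w \<in> space M" "i < d n" for w i
      using measurable_space[OF meas[OF r n] that(1)] that(2) j by (auto simp: space_mat_borel)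
    have m: "(\<lambda>w. A r n w $$ (i, j)) \<in> borel_measurable M" if "i < d n" for i
      using measurable_compose[OF meas[OF r n] measurable_mat_borel_index[OF that j]] .
    have sq: "integrable M (\<lambda>w. (A r n w $$ (i, j))\<^sup>2)" if "i < d n" for i
    proof -
      have "integrable M (\<lambda>w. (col (A r n w) j $ i)\<^sup>2)"
        using std[OF r n] that by (simp add: standardized_def)
      then show ?thesis
        by (subst Bochner_Integration.integrable_cong[OF refl]) (auto simp: col that)
    qed
    \<comment> \<open>On a finite measure space, square integrability implies integrability.\<close>
    have int1: "integrable M (\<lambda>w. A r n w $$ (i, j))" if "i < d n" for i
      using square_integrable_imp_integrable[OF m sq] that by simp
    have mean: "(\<integral>w. A r n w $$ (i, j) \<partial>M) = 0" if "i < d n" for i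
      using standardized_mean[OF std[OF r n] that]
      by (subst Bochner_Integration.integral_cong[OF refl]) (auto simp: col that)
    have int2: "integrable M (\<lambda>w. A r n w $$ (i, j) * A r n w $$ (i', j))"
      if "i < d n" "i' < d n" for i i'
      using that by (intro square_integrable_product m sq)
    have mom: "(\<integral>w. A r n w $$ (i, j) * A r n w $$ (i', j) \<partial>M) = of_bool (i = i')"
      if "i < d n" "i' < d n" for i i'
    proof -
      have "(\<integral>w. A r n w $$ (i, j) * A r n w $$ (i', j) \<partial>M) =
          (\<integral>w. col (A r n w) j $ i * col (A r n w) j $ i' \<partial>M)"
        by (intro Bochner_Integration.integral_cong) (auto simp: col that)
      then show ?thesis using standardized_second_moment[OF std[OF r n] that] by simp
    qed
    show ?thesis
      using int1 int2 mean mom p[OF n] q[OF n] by (auto simp: X_def g_def prob_space)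
  qed
  have fin: "finite ?I" and X_int': "\<And>rn. rn \<in> ?I \<Longrightarrow> integrable M (X rn)"
    using X_int by auto
  show "integrable M F"
    unfolding F_eq by (rule indep_vars_integrable[OF fin X_indep X_int'])
  have "expectation F = (\<Prod>rn\<in>?I. expectation (X rn))"
    unfolding F_eq by (rule indep_vars_lebesgue_integral[OF fin X_indep X_int'])
  also have "\<dots> = of_bool (t = s \<and> (\<forall>n\<in>{1..N}. p n = q n))"
  proof (cases "t = s \<and> (\<forall>n\<in>{1..N}. p n = q n)")
    case True
    then have "(\<Prod>rn\<in>?I. expectation (X rn)) = 1"
      using X_int by (intro prod.neutral) auto
    then show ?thesis using True by simp
  next
    case False
    \<comment> \<open>For equal replicas, a position with differing digits gives an off-diagonal
      covariance. For different replicas every factor of replica \<open>t\<close> is a mean, and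
      \<open>N \<ge> 1\<close> supplies position 1.\<close>
    have "\<exists>n\<in>{1..N}. expectation (X (t, n)) = 0"
    proof (cases "t = s")
      case True
      then show ?thesis using False X_int[OF t] by auto
    next
      case False
      then show ?thesis using N X_int[OF t] by (auto intro!: bexI[of _ 1])
    qed
    then have "(\<Prod>rn\<in>?I. expectation (X rn)) = 0"
      using t by (auto simp: prod_zero_iff)
    with False show ?thesis by (simp only: of_bool_eq)
  qed
  finally show "expectation F = of_bool (t = s \<and> (\<forall>n\<in>{1..N}. p n = q n))" .
qed

text \<open>Finite Parseval identity: after expanding the square, orthonormality leaves only the
  diagonal terms. Integrability of all pairwise products justifies exchanging sum and
  integral.\<close>

lemma integral_square_sum_orthonormal:
  fixes \<phi> :: "'i \<Rightarrow> 'w \<Rightarrow> real" and c :: "'i \<Rightarrow> real"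
  assumes "finite I"
    and "\<And>a b. a \<in> I \<Longrightarrow> b \<in> I \<Longrightarrow> integrable M (\<lambda>w. \<phi> a w * \<phi> b w)"
    and "\<And>a b. a \<in> I \<Longrightarrow> b \<in> I \<Longrightarrow> (\<integral>w. \<phi> a w * \<phi> b w \<partial>M) = of_bool (a = b)"
  shows "integrable M (\<lambda>w. (\<Sum>a\<in>I. c a * \<phi> a w)\<^sup>2)"
    and "(\<integral>w. (\<Sum>a\<in>I. c a * \<phi> a w)\<^sup>2 \<partial>M) = (\<Sum>a\<in>I. (c a)\<^sup>2)"
proof -
  have expand: "(\<lambda>w. (\<Sum>a\<in>I. c a * \<phi> a w)\<^sup>2) =
      (\<lambda>w. \<Sum>a\<in>I. \<Sum>b\<in>I. c a * c b * (\<phi> a w * \<phi> b w))"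
    by (simp add: power2_eq_square sum_product mult_ac)
  show "integrable M (\<lambda>w. (\<Sum>a\<in>I. c a * \<phi> a w)\<^sup>2)"
    unfolding expand using assms(2) by (intro Bochner_Integration.integrable_sum integrable_mult_right)
  have "(\<integral>w. (\<Sum>a\<in>I. c a * \<phi> a w)\<^sup>2 \<partial>M) = (\<Sum>a\<in>I. \<Sum>b\<in>I. c a * c b * of_bool (a = b))"
    unfolding expand using assms(2,3)
    by (simp add: Bochner_Integration.integral_sum)
  also have "\<dots> = (\<Sum>a\<in>I. (c a)\<^sup>2)"
    using assms(1) by (simp add: power2_eq_square of_bool_def if_distrib cong: if_cong)
  finally show "(\<integral>w. (\<Sum>a\<in>I. c a * \<phi> a w)\<^sup>2 \<partial>M) = (\<Sum>a\<in>I. (c a)\<^sup>2)" .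
qed

section \<open>Summation over columns, replicas and rows\<close>

theorem lemma3p1:
  fixes M :: "'w measure"
    and N T k :: nat and d :: "nat \<Rightarrow> nat"
    and x :: "real vec"
    and A :: "nat \<Rightarrow> nat \<Rightarrow> 'w \<Rightarrow> real mat"
  assumes "prob_space M"
    and "N \<ge> 1" and "T \<ge> 1" and "k \<ge> 1" and "\<forall>n\<in>{1..N}. d n \<ge> 1"
    and "x \<in> carrier_vec (\<Prod>n=1..N. d n)"
    and "\<forall>t\<in>{1..T}. \<forall>n\<in>{1..N}. A t n \<in> M \<rightarrow>\<^sub>M mat_borel (d n) k"
    and "\<forall>t\<in>{1..T}. \<forall>n\<in>{1..N}.
           prob_space.indep_vars M (\<lambda>j. vec_borel (d n)) (\<lambda>j w. col (A t n w) j) {..<k}"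
    and "\<forall>t\<in>{1..T}. \<forall>n\<in>{1..N}. \<forall>j<k. standardized M (d n) (\<lambda>w. col (A t n w) j)"
    and "prob_space.indep_vars M (\<lambda>(t, n). mat_borel (d n) k) (\<lambda>(t, n). A t n) ({1..T} \<times> {1..N})"
  shows "integrable M (\<lambda>w. (norm2_vec (trp_avg N k T (\<lambda>t n. A t n w) x))\<^sup>2) \<and>
         (\<integral>w. (norm2_vec (trp_avg N k T (\<lambda>t n. A t n w) x))\<^sup>2 \<partial>M) = (norm2_vec x)\<^sup>2"
proof -
  interpret prob_space M by fact
  let ?D = "\<Prod>n=1..N. d n"
  let ?I = "{1..T} \<times> {..<?D}"
  define \<phi> where
    "\<phi> = (\<lambda>j (t, i) w. \<Prod>n=1..N. A t n w $$ (radix_digit d N i n, j))"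
  define S where "S = (\<lambda>j w. (\<Sum>a\<in>?I. x $ snd a * \<phi> j a w)\<^sup>2)"
  have orth: "integrable M (\<lambda>w. \<phi> j a w * \<phi> j b w)"
    "(\<integral>w. \<phi> j a w * \<phi> j b w \<partial>M) = of_bool (a = b)"
    if j: "j < k" and ab: "a \<in> ?I" "b \<in> ?I" for j a b
  proof -
    obtain t i s i' where a: "a = (t, i)" and b: "b = (s, i')"
      by (cases a, cases b)
    have less: "radix_digit d N l n < d n" if "n \<in> {1..N}" for l n
      using assms(5) that by (intro radix_digit_less) (auto simp: Suc_le_eq)
    \<comment> \<open>Agreement of all digits becomes equality of rows; \<open>ab\<close> provides
      the bounds that injectivity needs.\<close>
    have inj: "(\<forall>n\<in>{1..N}. radix_digit d N i n = radix_digit d N i' n) \<longleftrightarrow> i = i'"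
      using ab radix_digit_inject[of i d N i'] by (auto simp: a b)
    note * = khatri_rao_entries_orthonormal[of N j k T A d t s "radix_digit d N i" "radix_digit d N i'"]
    show "integrable M (\<lambda>w. \<phi> j a w * \<phi> j b w)"
      unfolding a b \<phi>_def prod.case using assms(2,7,9,10) j ab less by (intro *(1)) (auto simp: a b)
    have "(\<integral>w. \<phi> j a w * \<phi> j b w \<partial>M) =
        of_bool (t = s \<and> (\<forall>n\<in>{1..N}. radix_digit d N i n = radix_digit d N i' n))"
      unfolding a b \<phi>_def prod.case using assms(2,7,9,10) j ab less by (intro *(2)) (auto simp: a b)
    then show "(\<integral>w. \<phi> j a w * \<phi> j b w \<partial>M) = of_bool (a = b)"
      unfolding inj by (simp add: a b)
  qed
  have S_int: "integrable M (S j)" and S_val: "(\<integral>w. S j w \<partial>M) = real T * (norm2_vec x)\<^sup>2"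
    if "j < k" for j
  proof -
    show "integrable M (S j)"
      unfolding S_def using that by (intro integral_square_sum_orthonormal orth) auto
    have "(\<integral>w. S j w \<partial>M) = (\<Sum>a\<in>?I. (x $ snd a)\<^sup>2)"
      unfolding S_def using that by (intro integral_square_sum_orthonormal orth) auto
    \<comment> \<open>The coefficients do not depend on the replica, which produces the factor
      \<open>T\<close>.\<close>
    also have "\<dots> = (\<Sum>t=1..T. \<Sum>i<?D. (x $ i)\<^sup>2)"
      unfolding sum.cartesian_product by (simp add: case_prod_unfold)
    also have "\<dots> = real T * (norm2_vec x)\<^sup>2"
      using assms(6) by (simp add: norm2_vec_sq)
    finally show "(\<integral>w. S j w \<partial>M) = real T * (norm2_vec x)\<^sup>2" .
  qed
  have eq: "(norm2_vec (trp_avg N k T (\<lambda>t n. A t n w) x))\<^sup>2 =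
      1 / (real T * real k) * (\<Sum>j<k. S j w)" if w: "w \<in> space M" for w
  proof -
    have "A t n w \<in> carrier_mat (d n) k" if "t \<in> {1..T}" "n \<in> {1..N}" for t n
      using assms(7) that measurable_space[OF _ w, of "A t n" "mat_borel (d n) k"]
      by (auto simp: space_mat_borel)
    from trp_avg_norm2_sq[OF assms(2) this assms(6)] show ?thesis
      by (simp add: S_def \<phi>_def case_prod_unfold)
  qed
  have "integrable M (\<lambda>w. 1 / (real T * real k) * (\<Sum>j<k. S j w))"
    using S_int by (intro integrable_mult_right Bochner_Integration.integrable_sum) auto
  then have "integrable M (\<lambda>w. (norm2_vec (trp_avg N k T (\<lambda>t n. A t n w) x))\<^sup>2)"
    by (subst Bochner_Integration.integrable_cong[OF refl eq])
  moreover have "(\<integral>w. (norm2_vec (trp_avg N k T (\<lambda>t n. A t n w) x))\<^sup>2 \<partial>M) = (norm2_vec x)\<^sup>2"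
  proof -
    have "(\<integral>w. (norm2_vec (trp_avg N k T (\<lambda>t n. A t n w) x))\<^sup>2 \<partial>M) =
        (\<integral>w. 1 / (real T * real k) * (\<Sum>j<k. S j w) \<partial>M)"
      by (intro Bochner_Integration.integral_cong refl eq)
    also have "\<dots> = 1 / (real T * real k) * (\<Sum>j<k. \<integral>w. S j w \<partial>M)"
      using S_int by (simp add: Bochner_Integration.integral_sum)
    \<comment> \<open>All \<open>k\<close> columns contribute the same value, so the total factor
      \<open>T * k\<close> cancels the normalization.\<close>
    also have "\<dots> = (norm2_vec x)\<^sup>2"
      using assms(3,4) by (simp add: S_val)
    finally show ?thesis .
  qed
  ultimately show ?thesis ..
qed

end
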